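(* For any integers $q\ge2$ and $k\ge2$, let $S\subset\mathbb{R}^{k+1}$ be the one-row Hermite normal form simplex with non-trivial row $(q^{k-1},\dots,q,1,q^k)$, i.e. the convex hull of $0,e_1,\dots,e_k$ and $(q^{k-1},q^{k-2},\dots,q,1,q^k)$. Then the local $h^*$-polynomial of $S$ is unimodal.
   Context: Here $e_i$ are the standard basis vectors. For a lattice simplex $S\subset\mathbb{R}^d$ of dimension $d$, let $A$ be the $(d+1)\times(d+1)$ matrix whose rows are the vertices of $S$ with an initial coordinate $1$ prepended. Put $\Lambda=\mathbb{Z}^{d+1}A^{-1}$ and $\Gamma=\Lambda/\mathbb{Z}^{d+1}$. For $x=(x_0,\dots,x_d)\in\Lambda$ let $\mathrm{age}(x)=\sum_{i=0}^d\{x_i\}$, where $\{t\}=t-\lfloor t\rfloor$; this depends only on the class in $\Gamma$. The local $h^*$-polynomial is $B(S;z)=\sum_x z^{\mathrm{age}(x)}$, the sum over those $x\in\Gamma$ none of whose coordinates is an integer. A polynomial is unimodal if its coefficient sequence weakly increases up to some index and weakly decreases afterwards. Here $d=k+1$. *)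

theory Defs
  imports "HOL-Analysis.Analysis" "HOL-Computational_Algebra.Polynomial"
begin

definition int_vecs :: "(real ^ 'm::finite) set" where
  "int_vecs = {z. \<forall>i. z $ i \<in> \<int>}"

(* A simplex in real^'n with CARD('n) = d has d + 1 vertices; both the vertices and
   the coordinates of the homogenised vertices are labelled by 'n option, where the
   column None is the prepended coordinate. *)
definition hom_matrix :: "('n option \<Rightarrow> real ^ 'n::finite) \<Rightarrow> real ^ 'n option ^ 'n option" where
  "hom_matrix v = (\<chi> r c. case c of None \<Rightarrow> 1 | Some j \<Rightarrow> v r $ j)"

(* Reordering the vertices only permutes the coordinates of the vectors in Lambda
   below, so that the polynomial local_hstar does not depend on the choice made here. *)
definition vertex_enum :: "(real ^ 'n::finite) set \<Rightarrow> 'n option \<Rightarrow> real ^ 'n" where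
  "vertex_enum S = (SOME v. bij_betw v UNIV {x. x extreme_point_of S})"

definition Lambda :: "(real ^ 'n::finite) set \<Rightarrow> (real ^ 'n option) set" where
  "Lambda S = {z v* matrix_inv (hom_matrix (vertex_enum S)) | z. z \<in> int_vecs}"

definition Gamma :: "(real ^ 'n::finite) set \<Rightarrow> (real ^ 'n option) set set" where
  "Gamma S = Lambda S // {(x, y). x \<in> Lambda S \<and> y \<in> Lambda S \<and> x - y \<in> int_vecs}"

definition age :: "real ^ 'm::finite \<Rightarrow> real" where
  "age x = (\<Sum>i\<in>UNIV. frac (x $ i))"

(* The age is constant on each class, and it is a natural number because the first
   column of the matrix consists of ones, so that the coordinates of a vector in
   Lambda add up to an integer. *)
definition class_age :: "(real ^ 'm::finite) set \<Rightarrow> nat" where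
  "class_age X = nat \<lfloor>age (SOME x. x \<in> X)\<rfloor>"

definition local_hstar :: "(real ^ 'n::finite) set \<Rightarrow> int poly" where
  "local_hstar S =
     (\<Sum>X\<in>{X \<in> Gamma S. \<forall>x\<in>X. \<forall>i. x $ i \<notin> \<int>}. monom 1 (class_age X))"

definition unimodal :: "'a::{zero,linorder} poly \<Rightarrow> bool" where
  "unimodal p \<longleftrightarrow>
     (\<exists>m\<le>degree p. mono_on {..m} (coeff p) \<and> antimono_on {m..degree p} (coeff p))"

(* The bijection \<iota> from {1..CARD('n)} to 'n numbers the coordinates, so that
   axis (\<iota> i) 1 is the i-th standard basis vector; a 1, ..., a CARD('n) are the
   entries of the non-trivial row. *)
definition one_row_hnf_simplex :: "(nat \<Rightarrow> 'n) \<Rightarrow> (nat \<Rightarrow> int) \<Rightarrow> (real ^ 'n::finite) set" where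
  "one_row_hnf_simplex \<iota> a =
     convex hull ({0} \<union> {axis (\<iota> i) 1 | i. 1 \<le> i \<and> i < CARD('n)}
                  \<union> {\<Sum>i = 1..CARD('n). of_int (a i) *\<^sub>R axis (\<iota> i) 1})"

end

theory Submission imports Defs begin

text \<open>
  The group \<open>\<Gamma>\<close> is cyclic of order \<open>q^k\<close>: the class with last coordinate \<open>l / q^k\<close> has
  coordinates \<open>- l / q^i\<close> at \<open>e\<^sub>i\<close> and \<open>l / q + \<dots> + l / q^(k-1)\<close> at the origin. None of them is an
  integer iff \<open>q\<close> does not divide \<open>l\<close>, and then the age is
  \<open>k - \<lfloor>{l / q} + \<dots> + {l / q^(k-1)}\<rfloor> = k - \<lfloor>(s - 1) / (q - 1)\<rfloor>\<close>, where \<open>s\<close> is the sum of the lowest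
  \<open>k - 1\<close> base-\<open>q\<close> digits of \<open>l\<close>. So, up to the factor \<open>q\<close> for the free top digit, the coefficients
  are sums over consecutive blocks of \<open>q - 1\<close> values of the distribution of \<open>s\<close>. This distribution
  has generating function
  \<open>(x + \<dots> + x^(q-1)) (1 + x + \<dots> + x^(q-1))^(k-2)\<close>, and multiplication by a polynomial
  \<open>1 + x + \<dots> + x^(w-1)\<close> preserves symmetric unimodality. Hence the coefficients form the restriction of a
  symmetric unimodal sequence to an arithmetic progression.
\<close>

section \<open>Symmetric unimodal functions\<close>

text \<open>The value of \<open>c\<close> at \<open>i\<close> is a decreasing function of the distance from \<open>i\<close> to
  \<open>\<sigma> / 2\<close>; this encodes both symmetry and unimodality.\<close>

definition centred :: "int \<Rightarrow> (int \<Rightarrow> int) \<Rightarrow> bool" where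
  "centred \<sigma> c \<longleftrightarrow> (\<forall>i j. \<bar>2 * i - \<sigma>\<bar> \<le> \<bar>2 * j - \<sigma>\<bar> \<longrightarrow> c j \<le> c i)"

lemma centredD: "centred \<sigma> c \<Longrightarrow> \<bar>2 * i - \<sigma>\<bar> \<le> \<bar>2 * j - \<sigma>\<bar> \<Longrightarrow> c j \<le> c i"
  unfolding centred_def by blast

text \<open>Reflection in \<open>\<sigma> / 2\<close> moves both arguments to the left half, where
  being closer to the centre means being larger and the step condition gives monotonicity.\<close>

lemma centredI:
  assumes sym: "\<And>m. c (\<sigma> - m) = c m"
    and step: "\<And>m. 2 * m < \<sigma> \<Longrightarrow> c m \<le> c (m + 1)"
  shows "centred \<sigma> c"
proof -
  have mono: "c j \<le> c i" if "j \<le> i" "2 * i \<le> \<sigma>" for i j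
    using that
  proof (induction i rule: int_ge_induct)
    case (step i)
    then show ?case using assms(2)[of i] by simp
  qed simp
  have fold: "c m = c (min m (\<sigma> - m))" for m
    by (simp add: min_def sym)
  show ?thesis
    unfolding centred_def
  proof (intro allI impI)
    fix i j :: int
    assume "\<bar>2 * i - \<sigma>\<bar> \<le> \<bar>2 * j - \<sigma>\<bar>"
    then have "c (min j (\<sigma> - j)) \<le> c (min i (\<sigma> - i))"
      by (intro mono) (auto simp: min_def abs_if split: if_splits)
    then show "c j \<le> c i"
      by (simp flip: fold)
  qed
qed

text \<open>Window sums are the convolution with \<open>1 + x + ... + x^(w-1)\<close>. Consecutive
  sums differ by \<open>c (m + 1) - c (m + 1 - w)\<close>; to the left of the new centre,
  \<open>m + 1\<close> is at least as close to \<open>\<sigma> / 2\<close> as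
  \<open>m + 1 - w\<close>.\<close>

lemma centred_window:
  assumes "centred \<sigma> c"
  shows "centred (\<sigma> + int w - 1) (\<lambda>m. \<Sum>j<w. c (m - int j))"
proof (rule centredI)
  fix m :: int
  have "(\<Sum>j<w. c (\<sigma> + int w - 1 - m - int j)) = (\<Sum>j<w. c (m - int (w - Suc j)))"
  proof (rule sum.cong[OF refl])
    fix j assume "j \<in> {..<w}"
    then have *: "\<sigma> + int w - 1 - m - int j = \<sigma> - (m - int (w - Suc j))"
      by (simp add: of_nat_diff)
    show "c (\<sigma> + int w - 1 - m - int j) = c (m - int (w - Suc j))"
      unfolding * by (intro antisym centredD[OF assms]) auto
  qed
  also have "\<dots> = (\<Sum>j<w. c (m - int j))"
    by (rule sum.nat_diff_reindex)
  finally show "(\<Sum>j<w. c (\<sigma> + int w - 1 - m - int j)) = (\<Sum>j<w. c (m - int j))" .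
next
  fix m :: int
  assume m: "2 * m < \<sigma> + int w - 1"
  have "(\<Sum>j<w. c (m + 1 - int j)) + c (m + 1 - int w) = (\<Sum>j<Suc w. c (m + 1 - int j))"
    by simp
  also have "\<dots> = c (m + 1) + (\<Sum>j<w. c (m - int j))"
    by (subst sum.lessThan_Suc_shift) simp
  finally have "(\<Sum>j<w. c (m + 1 - int j)) + c (m + 1 - int w)
    = c (m + 1) + (\<Sum>j<w. c (m - int j))" .
  moreover have "c (m + 1 - int w) \<le> c (m + 1)"
    using m by (intro centredD[OF assms]) (auto simp: abs_if)
  ultimately show "(\<Sum>j<w. c (m - int j)) \<le> (\<Sum>j<w. c (m + 1 - int j))"
    by simp
qed

text \<open>The distance from the centre is the absolute value of an affine function of the index,
  so it falls and then rises along the progression, whatever the sign of \<beta>.\<close>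

lemma unimodal_if_centred:
  fixes p :: "int poly"
  assumes c: "centred \<sigma> c" and coeff: "\<And>j. coeff p j = c (\<alpha> - \<beta> * int j)"
  shows "unimodal p"
proof -
  define g where "g j = 2 * (\<alpha> - \<beta> * int j) - \<sigma>" for j
  have le: "coeff p i \<le> coeff p j" if "\<bar>g j\<bar> \<le> \<bar>g i\<bar>" for i j
    using that unfolding coeff g_def by (rule centredD[OF c])
  have convex: "\<bar>g j\<bar> \<le> max \<bar>g i\<bar> \<bar>g m\<bar>" if "i \<le> j" "j \<le> m" for i j m
  proof -
    have "min (\<beta> * int i) (\<beta> * int m) \<le> \<beta> * int j" "\<beta> * int j \<le> max (\<beta> * int i) (\<beta> * int m)"
      using that by (cases "\<beta> \<ge> 0";
          force simp: min_def max_def mult_left_mono mult_left_mono_neg)+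
    then show ?thesis
      unfolding g_def by (simp add: min_def max_def abs_if split: if_splits)
  qed
  \<comment> \<open>The peak is an index nearest to the centre among those up to the degree, as
    \<open>unimodal\<close> asks for \<open>m \<le> degree p\<close>.\<close>
  have "\<exists>m\<in>{..degree p}. \<forall>j\<in>{..degree p}. \<bar>g m\<bar> \<le> \<bar>g j\<bar>"
    using ex_min_if_finite[of "(\<lambda>j. \<bar>g j\<bar>) ` {..degree p}"] by (force simp: not_less)
  then obtain m where m: "m \<le> degree p" "\<And>j. j \<le> degree p \<Longrightarrow> \<bar>g m\<bar> \<le> \<bar>g j\<bar>"
    by auto
  have "mono_on {..m} (coeff p)"
  proof (rule mono_onI)
    fix i j assume "i \<in> {..m}" "j \<in> {..m}" "i \<le> j"
    then show "coeff p i \<le> coeff p j"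
      using convex[of i j m] m(1) m(2)[of i] by (intro le) auto
  qed
  moreover have "antimono_on {m..degree p} (coeff p)"
  proof (rule monotone_onI)
    fix i j assume "i \<in> {m..degree p}" "j \<in> {m..degree p}" "i \<le> j"
    then show "coeff p i \<ge> coeff p j"
      using convex[of m i j] m(2)[of j] by (intro le) auto
  qed
  ultimately show ?thesis
    unfolding unimodal_def using m(1) by blast
qed

section \<open>Digit sums\<close>

definition digit_sum :: "nat \<Rightarrow> nat \<Rightarrow> nat \<Rightarrow> nat" where
  "digit_sum q n l = (\<Sum>i<n. l div q ^ i mod q)"

lemma digit_sum_mod: "digit_sum q n (l mod q ^ n) = digit_sum q n l"
  unfolding digit_sum_def
proof (rule sum.cong[OF refl])
  fix i assume "i \<in> {..<n}"
  then obtain d where n: "n = i + Suc d"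
    by (metis lessThan_iff less_imp_Suc_add add_Suc_right)
  have "l mod q ^ n div q ^ i = l div q ^ i mod q ^ Suc d"
    unfolding n power_add by (cases "q = 0") (simp_all add: mod_mult2_eq)
  then show "l mod q ^ n div q ^ i mod q = l div q ^ i mod q"
    by (simp add: mod_mod_cancel)
qed

lemma digit_sum_Suc: "digit_sum q (Suc n) l = digit_sum q n (l mod q ^ n) + l div q ^ n mod q"
  unfolding digit_sum_mod by (simp add: digit_sum_def)

text \<open>The lowest digit is already non-zero. Positivity makes the truncated difference
  \<open>digit_sum q n l - 1\<close> a genuine one.\<close>

lemma digit_sum_pos:
  assumes "\<not> q dvd l" "n > 0"
  shows "digit_sum q n l > 0"
proof -
  have "0 < l div q ^ 0 mod q"
    using assms by (simp add: mod_greater_zero_iff_not_dvd)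
  also have "\<dots> \<le> digit_sum q n l"
    unfolding digit_sum_def using assms by (intro member_le_sum) auto
  finally show ?thesis .
qed

text \<open>Based on the bijection \<open>(d, l) -> d * q^n + l\<close>. It serves both the
  recursion for digit sums and the factor \<open>q\<close> contributed by a free top digit.\<close>

lemma card_split_top_digit:
  fixes q n :: nat
  assumes "q > 0"
  shows "card {l. l < q ^ Suc n \<and> P (l div q ^ n) (l mod q ^ n)}
    = (\<Sum>d<q. card {l. l < q ^ n \<and> P d l})"
proof -
  have lt: "d * q ^ n + l < q ^ Suc n" if "d < q" "l < q ^ n" for d l
  proof -
    have "d * q ^ n + l < Suc d * q ^ n" using that by simp
    also have "\<dots> \<le> q * q ^ n" using that by (intro mult_right_mono) auto
    finally show ?thesis by simp
  qed
  have "bij_betw (\<lambda>(d, l). d * q ^ n + l) (SIGMA d:{..<q}. {l. l < q ^ n \<and> P d l})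
    {l. l < q ^ Suc n \<and> P (l div q ^ n) (l mod q ^ n)}"
    using assms lt
    by (intro bij_betw_byWitness[where f' = "\<lambda>l. (l div q ^ n, l mod q ^ n)"])
      (auto simp: less_mult_imp_div_less div_mult_mod_eq)
  from bij_betw_same_card[OF this] show ?thesis
    by simp
qed

text \<open>For positive \<open>q\<close> and \<open>n\<close>, the coefficient of
  \<open>x^m\<close> in \<open>(x + ... + x^(q-1)) (1 + ... + x^(q-1))^(n-1)\<close>. Integer
  arguments let windows run past the support.\<close>

definition digit_sum_count :: "nat \<Rightarrow> nat \<Rightarrow> int \<Rightarrow> int" where
  "digit_sum_count q n m = int (card {l. l < q ^ n \<and> \<not> q dvd l \<and> int (digit_sum q n l) = m})"

lemma digit_sum_count_1:
  assumes "q > 0"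
  shows "digit_sum_count q 1 m = of_bool (1 \<le> m \<and> m < int q)"
proof -
  have "x \<in> {l. l < q ^ 1 \<and> \<not> q dvd l \<and> int (digit_sum q 1 l) = m}
    \<longleftrightarrow> x \<in> (if 1 \<le> m \<and> m < int q then {nat m} else {})" for x
  proof (cases "0 < x \<and> x < q")
    case True
    then have "\<not> q dvd x"
      by (intro nat_dvd_not_less) auto
    then show ?thesis
      using True by (auto simp: digit_sum_def)
  next
    case False
    then have "x = 0 \<or> \<not> x < q"
      by auto
    moreover have "x \<noteq> nat m" if "1 \<le> m" "m < int q"
      using that False by linarith
    ultimately show ?thesis
      by auto
  qed
  then have "{l. l < q ^ 1 \<and> \<not> q dvd l \<and> int (digit_sum q 1 l) = m}
    = (if 1 \<le> m \<and> m < int q then {nat m} else {})"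
    by (rule set_eqI)
  then show ?thesis
    by (simp add: digit_sum_count_def)
qed

text \<open>The new top digit ranges over all of \<open>0, ..., q - 1\<close>: as
  \<open>n > 0\<close>, it is not the lowest digit and does not affect divisibility by
  \<open>q\<close>.\<close>

lemma digit_sum_count_Suc:
  assumes "q > 0" "n > 0"
  shows "digit_sum_count q (Suc n) m = (\<Sum>d<q. digit_sum_count q n (m - int d))"
proof -
  have dvd: "q dvd l mod q ^ n \<longleftrightarrow> q dvd l" for l
    using assms by (simp add: dvd_mod_iff)
  have mod: "l div q ^ n mod q = l div q ^ n" if "l < q ^ Suc n" for l
    using that by (simp add: less_mult_imp_div_less)
  have "digit_sum_count q (Suc n) m = int (card {l. l < q ^ Suc n \<and>
      (\<not> q dvd l mod q ^ n \<and> int (digit_sum q n (l mod q ^ n) + l div q ^ n) = m)})"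
    unfolding digit_sum_count_def dvd digit_sum_Suc
    by (intro arg_cong[where f = "\<lambda>A. int (card A)"] Collect_cong conj_cong refl)
      (simp only: mod)
  also have "\<dots> = (\<Sum>d<q. digit_sum_count q n (m - int d))"
    unfolding card_split_top_digit[OF assms(1),
        where P = "\<lambda>d l. \<not> q dvd l \<and> int (digit_sum q n l + d) = m"] of_nat_sum
      digit_sum_count_def
    by (intro sum.cong refl arg_cong[where f = "\<lambda>A. int (card A)"]) auto
  finally show ?thesis .
qed

text \<open>One digit gives the constant block on \<open>1, ..., q - 1\<close>, centred at
  \<open>q / 2\<close>; each further digit is a window of width \<open>q\<close>.\<close>

lemma digit_sum_count_centred:
  assumes "q > 0" "n > 0"
  shows "\<exists>\<sigma>. centred \<sigma> (digit_sum_count q n)"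
  using \<open>n > 0\<close>
proof (induction n rule: nat_induct_non_zero)
  case 1
  have "centred (int q) (digit_sum_count q 1)"
    unfolding centred_def digit_sum_count_1[OF \<open>q > 0\<close>] by (auto simp: abs_if split: if_splits)
  then show ?case by blast
next
  case (Suc n)
  then obtain \<sigma> where "centred \<sigma> (digit_sum_count q n)"
    by blast
  moreover have "digit_sum_count q (Suc n) = (\<lambda>m. \<Sum>d<q. digit_sum_count q n (m - int d))"
    by (rule ext) (rule digit_sum_count_Suc[OF \<open>q > 0\<close> \<open>n > 0\<close>])
  ultimately show ?case
    using centred_window[of \<sigma> "digit_sum_count q n" q] by auto
qed

lemma int_div_eq_iff:
  fixes a b r :: int
  assumes "b > 0"
  shows "a div b = r \<longleftrightarrow> b * r \<le> a \<and> a < b * (r + 1)"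
proof
  assume "a div b = r"
  then have "b * r + a mod b = a"
    using mult_div_mod_eq[of b a] by simp
  then show "b * r \<le> a \<and> a < b * (r + 1)"
    using pos_mod_bound[OF assms, of a] pos_mod_sign[OF assms, of a]
    unfolding distrib_left by auto
next
  assume "b * r \<le> a \<and> a < b * (r + 1)"
  then show "a div b = r"
    by (intro int_div_pos_eq[of a b r "a - b * r"]) (auto simp: algebra_simps)
qed

text \<open>For \<open>s > 0\<close> the quotient is \<open>r\<close> iff \<open>s\<close> is one of
  the \<open>q - 1\<close> values from \<open>(q - 1) r + 1\<close> to
  \<open>(q - 1) (r + 1)\<close>. They are listed downwards from the last to match
  \<open>centred_window\<close>.\<close>

lemma card_digit_sum_block:
  assumes "q \<ge> 2" "n > 0"
  shows "int (card {l. l < q ^ n \<and> \<not> q dvd l \<and> int ((digit_sum q n l - 1) div (q - 1)) = r})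
    = (\<Sum>j<q - 1. digit_sum_count q n ((int q - 1) * (r + 1) - int j))"
proof -
  let ?A = "\<lambda>j. {l. l < q ^ n \<and> \<not> q dvd l \<and> int (digit_sum q n l) = (int q - 1) * (r + 1) - int j}"
  have iff: "int ((s - 1) div (q - 1)) = r
      \<longleftrightarrow> (\<exists>j<q - 1. int s = (int q - 1) * (r + 1) - int j)" if "s > 0" for s :: nat
  proof -
    have "int ((s - 1) div (q - 1)) = (int s - 1) div (int q - 1)"
      using that assms by (simp add: zdiv_int of_nat_diff)
    also have "\<dots> = r \<longleftrightarrow> (int q - 1) * r \<le> int s - 1 \<and> int s - 1 < (int q - 1) * (r + 1)"
      using assms by (intro int_div_eq_iff) simp
    also have "\<dots> \<longleftrightarrow> (\<exists>j<q - 1. int s = (int q - 1) * (r + 1) - int j)"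
      (is "?l \<longleftrightarrow> ?r")
    proof
      assume ?l
      then show ?r
        using assms by (intro exI[of _ "nat ((int q - 1) * (r + 1) - int s)"])
          (auto simp: algebra_simps nat_less_iff of_nat_diff)
    qed (auto simp: algebra_simps)
    finally show ?thesis .
  qed
  have "l < q ^ n \<and> \<not> q dvd l \<and> int ((digit_sum q n l - 1) div (q - 1)) = r
    \<longleftrightarrow> (\<exists>j<q - 1. l \<in> ?A j)" for l
  proof (cases "q dvd l")
    case False
    show ?thesis
      unfolding mem_Collect_eq iff[OF digit_sum_pos[OF False \<open>n > 0\<close>]] by blast
  qed simp
  then have "{l. l < q ^ n \<and> \<not> q dvd l \<and> int ((digit_sum q n l - 1) div (q - 1)) = r}
    = (\<Union>j<q - 1. ?A j)"
    by blast
  moreover have "card (\<Union>j<q - 1. ?A j) = (\<Sum>j<q - 1. card (?A j))"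
    by (rule card_UN_disjoint) auto
  ultimately show ?thesis
    by (simp add: digit_sum_count_def)
qed

section \<open>Sums of fractional parts\<close>

lemma frac_of_nat_div:
  fixes l m :: nat
  assumes "m > 0"
  shows "frac (real l / real m) = real (l mod m) / real m"
proof -
  have "real l / real m - real_of_int (int (l div m)) = real (l mod m) / real m"
    using assms by (simp add: field_simps flip: of_nat_mult of_nat_add)
  moreover have "\<lfloor>real l / real m\<rfloor> = int (l div m)"
    by (simp add: floor_divide_of_nat_eq)
  ultimately show ?thesis
    by (simp add: frac_def)
qed

text \<open>A digit \<open>d\<close> at place \<open>p < n\<close> contributes
  \<open>d * q^p / q^i\<close> for \<open>i = p + 1, ..., n\<close>; times \<open>q - 1\<close>,
  this geometric sum is \<open>d - d * q^p / q^n\<close>.\<close>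

lemma sum_frac_eq_digit_sum:
  assumes "q > 0"
  shows "(real q - 1) * (\<Sum>i=1..n. frac (real l / real q ^ i))
    = real (digit_sum q n l) - real (l mod q ^ n) / real q ^ n"
proof (induction n)
  case 0
  then show ?case by (simp add: digit_sum_def)
next
  case (Suc n)
  define M d where "M = l mod q ^ n" and "d = l div q ^ n mod q"
  have "l mod q ^ Suc n = q ^ n * d + M"
    unfolding M_def d_def by (simp add: mult.commute[of q] mod_mult2_eq)
  then have M': "real (l mod q ^ Suc n) = real q ^ n * real d + real M"
    by simp
  have "frac (real l / real q ^ Suc n) = real (l mod q ^ Suc n) / real q ^ Suc n"
    using frac_of_nat_div[of "q ^ Suc n" l] assms by simp
  then have "(real q - 1) * (\<Sum>i=1..Suc n. frac (real l / real q ^ i))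
    = (real (digit_sum q n l) - real M / real q ^ n)
      + (real q - 1) * ((real q ^ n * real d + real M) / real q ^ Suc n)"
    using Suc unfolding M' M_def by (simp add: distrib_left)
  \<comment> \<open>With \<open>N = q^n * d + M\<close> one has
    \<open>q * N / q^(n+1) = d + M / q^n\<close>: the old error term cancels and
    \<open>- N / q^(n+1)\<close> is the new one.\<close>
  also have "\<dots> = real (digit_sum q n l) + real d
      - (real q ^ n * real d + real M) / real q ^ Suc n"
    using assms by (simp add: field_simps)
  also have "real (digit_sum q n l) + real d = real (digit_sum q (Suc n) l)"
    by (simp add: digit_sum_def d_def)
  finally show ?case
    unfolding M' .
qed

text \<open>\<open>(q - 1) * S = s - \<epsilon>\<close> lies strictly between the consecutive
  integers \<open>s - 1\<close> and \<open>s\<close>, so the floor of \<open>S\<close> is that of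
  \<open>(s - 1) / (q - 1)\<close>.\<close>

lemma floor_sum_frac:
  assumes "q \<ge> 2" "n > 0" "\<not> q dvd l"
  shows "\<lfloor>\<Sum>i=1..n. frac (real l / real q ^ i)\<rfloor> = int ((digit_sum q n l - 1) div (q - 1))"
proof -
  define s where "s = digit_sum q n l"
  define \<epsilon> where "\<epsilon> = real (l mod q ^ n) / real q ^ n"
  define S where "S = (\<Sum>i=1..n. frac (real l / real q ^ i))"
  have "l mod q ^ n > 0"
    using assms by (metis dvd_power dvd_trans mod_greater_zero_iff_not_dvd)
  moreover have "real (l mod q ^ n) < real (q ^ n)"
    using assms by simp
  ultimately have \<epsilon>: "0 < \<epsilon>" "\<epsilon> < 1"
    using assms by (simp_all add: \<epsilon>_def)
  have s: "s > 0"
    unfolding s_def using assms by (intro digit_sum_pos)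
  have S: "(real q - 1) * S = real s - \<epsilon>"
    unfolding S_def s_def \<epsilon>_def using assms by (intro sum_frac_eq_digit_sum) auto
  define r where "r = (s - 1) div (q - 1)"
  define t where "t = (s - 1) mod (q - 1)"
  \<comment> \<open>This leads to \<open>r (q - 1) \<le> s - 1 < s - \<epsilon> < s \<le> (r + 1) (q
    - 1)\<close>.\<close>
  have "s - 1 = r * (q - 1) + t" "t < q - 1"
    unfolding r_def t_def using assms by (simp_all only: div_mult_mod_eq) simp
  then have "s = r * (q - 1) + t + 1" "t + 1 \<le> q - 1"
    using s by simp_all
  then have "real s = real (r * (q - 1) + t + 1)" "real (t + 1) \<le> real (q - 1)"
    by (simp_all only: of_nat_le_iff)
  then have "real s = real r * (real q - 1) + real t + 1" "real t + 1 \<le> real q - 1"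
    using assms by (simp_all add: of_nat_diff)
  then have "(real q - 1) * real r \<le> (real q - 1) * S" "(real q - 1) * S < (real q - 1) * (real r + 1)"
    unfolding S using \<epsilon> by (simp_all add: algebra_simps)
  then have "real r \<le> S" "S < real r + 1"
    using assms by simp_all
  then show ?thesis
    unfolding S_def[symmetric] s_def[symmetric] r_def[symmetric] by (simp add: floor_eq_iff)
qed

section \<open>The lattice of the simplex\<close>

locale geometric_row =
  fixes q k :: nat and \<iota> :: "nat \<Rightarrow> 'n::finite"
  assumes q: "q \<ge> 2" and k: "k \<ge> 2"
    and card: "CARD('n) = k + 1"
    and bij: "bij_betw \<iota> {1..k + 1} UNIV"
begin

abbreviation row_simplex :: "(real ^ 'n) set" where
  "row_simplex \<equiv> one_row_hnf_simplex \<iota> (\<lambda>i. if i \<le> k then int q ^ (k - i) else int q ^ k)"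

text \<open>A concrete numbering by \<open>0, ..., k + 1\<close>, origin first and non-trivial row
  last, independent of the arbitrary choice in \<open>vertex_enum\<close>.\<close>

definition vertex :: "nat \<Rightarrow> real ^ 'n" where
  "vertex i = (if i = 0 then 0 else if i \<le> k then axis (\<iota> i) 1
    else (\<Sum>m = 1..k + 1. (if m \<le> k then real q ^ (k - m) else real q ^ k) *\<^sub>R axis (\<iota> m) 1))"

lemma vertex_nth:
  assumes m: "m \<in> {1..k + 1}"
  shows "vertex i $ \<iota> m = (if i = 0 then 0 else if i \<le> k then of_bool (i = m)
    else if m \<le> k then real q ^ (k - m) else real q ^ k)"
proof -
  have inj: "\<iota> m = \<iota> j \<longleftrightarrow> j = m" if "j \<in> {1..k + 1}" for j
    using inj_on_eq_iff[OF bij_betw_imp_inj_on[OF bij] m that] by blast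
  have "(\<Sum>j = 1..k + 1. (if j \<le> k then real q ^ (k - j) else real q ^ k) * (axis (\<iota> j) 1 $ \<iota> m))
    = (\<Sum>j = 1..k + 1. if j = m then (if j \<le> k then real q ^ (k - j) else real q ^ k) else 0)"
    using inj by (intro sum.cong refl) (auto simp: axis_def)
  also have "\<dots> = (if m \<le> k then real q ^ (k - m) else real q ^ k)"
    using m by (subst sum.delta) auto
  finally show ?thesis
    using inj[of i] unfolding vertex_def by (auto simp: axis_def)
qed

lemma simplex_eq: "row_simplex = convex hull (vertex ` {..k + 1})"
proof -
  have "{..k + 1} = {0} \<union> {1..<k + 1} \<union> {k + 1}"
    by auto
  then have "vertex ` {..k + 1} = {vertex 0} \<union> vertex ` {1..<k + 1} \<union> {vertex (k + 1)}"
    by (simp only: image_Un image_insert image_empty)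
  also have "vertex ` {1..<k + 1} = {axis (\<iota> i) 1 | i. 1 \<le> i \<and> i < CARD('n)}"
    unfolding card by (force simp: vertex_def)
  also have "vertex (k + 1)
    = (\<Sum>i = 1..CARD('n). of_int (if i \<le> k then int q ^ (k - i) else int q ^ k) *\<^sub>R axis (\<iota> i) 1)"
    unfolding vertex_def card by (auto intro!: sum.cong)
  finally show ?thesis
    unfolding one_row_hnf_simplex_def by (simp add: vertex_def)
qed

lemma inj_vertex: "inj_on vertex {..k + 1}"
proof (rule linorder_inj_onI)
  fix i j assume "i < j" "i \<in> {..k + 1}" "j \<in> {..k + 1}"
  then have "vertex i $ \<iota> j \<noteq> vertex j $ \<iota> j"
    using q by (auto simp: vertex_nth)
  then show "vertex i \<noteq> vertex j" by auto
qed auto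

lemma sum_vertex_nth:
  assumes "m \<in> {1..k + 1}"
  shows "(\<Sum>i\<le>k + 1. y i * vertex i $ \<iota> m)
    = (if m \<le> k then y m + y (k + 1) * real q ^ (k - m) else y (k + 1) * real q ^ k)"
proof -
  have "(\<Sum>i\<le>k. y i * vertex i $ \<iota> m) = (\<Sum>i\<le>k. if i = m then y i else 0)"
    using assms by (intro sum.cong) (auto simp: vertex_nth)
  then show ?thesis
    using assms by (auto simp: vertex_nth)
qed

text \<open>Back substitution: column \<open>k + 1\<close> isolates \<open>y (k + 1)\<close>, the
  other columns then give \<open>y m\<close>, and the plain sum gives \<open>y 0\<close>. Both
  affine independence of the vertices and invertibility of the matrix rest on this.\<close>

lemma vertices_independent:
  assumes sum: "(\<Sum>i\<le>k + 1. y i) = 0"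
    and comb: "\<And>m. m \<in> {1..k + 1} \<Longrightarrow> (\<Sum>i\<le>k + 1. y i * vertex i $ \<iota> m) = 0"
    and i: "i \<le> k + 1"
  shows "y i = 0"
proof -
  have last: "y (k + 1) = 0"
    using comb[of "k + 1"] q sum_vertex_nth[of "k + 1" y] by (simp del: sum.atMost_Suc)
  have mid: "y m = 0" if "m \<in> {1..k}" for m
    using comb[of m] that last sum_vertex_nth[of m y] by (simp del: sum.atMost_Suc)
  have "(\<Sum>i\<le>k. y i) = (\<Sum>i\<in>{0}. y i)"
    using mid by (intro sum.mono_neutral_right) auto
  then have "y 0 = 0"
    using sum last by simp
  with last mid i show ?thesis
    by (cases "i = 0"; cases "i = k + 1") auto
qed

lemma affine_independent_vertices: "\<not> affine_dependent (vertex ` {..k + 1})"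
proof
  assume "affine_dependent (vertex ` {..k + 1})"
  then obtain u where u: "sum u (vertex ` {..k + 1}) = 0"
    "\<exists>v\<in>vertex ` {..k + 1}. u v \<noteq> 0" "(\<Sum>v\<in>vertex ` {..k + 1}. u v *\<^sub>R v) = 0"
    unfolding affine_dependent_explicit_finite[OF finite_imageI[OF finite_atMost]] by blast
  have sum0: "(\<Sum>i\<le>k + 1. u (vertex i)) = 0"
    using u(1) by (simp only: sum.reindex[OF inj_vertex] comp_def)
  have "(\<Sum>i\<le>k + 1. u (vertex i) *\<^sub>R vertex i) = 0"
    using u(3) by (simp only: sum.reindex[OF inj_vertex] comp_def)
  then have "(\<Sum>i\<le>k + 1. u (vertex i) *\<^sub>R vertex i) $ \<iota> m = 0" for m
    by simp
  then have "(\<Sum>i\<le>k + 1. u (vertex i) * vertex i $ \<iota> m) = 0" for m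
    by (simp only: sum_component vector_scaleR_component real_scaleR_def)
  from vertices_independent[of "\<lambda>i. u (vertex i)", OF sum0 this]
  show False
    using u(2) by blast
qed

text \<open>By affine independence the extreme points are exactly the \<open>k + 2\<close> listed
  vertices, so the choice in \<open>vertex_enum\<close> has a witness.\<close>

lemma bij_vertex_enum: "bij_betw (vertex_enum row_simplex) UNIV (vertex ` {..k + 1})"
proof -
  have extr: "{x. x extreme_point_of row_simplex} = vertex ` {..k + 1}"
    using affine_independent_vertices unfolding simplex_eq
    by (auto simp: extreme_point_of_convex_hull_affine_independent)
  have "card (UNIV :: 'n option set) = card (vertex ` {..k + 1})"
    unfolding card_image[OF inj_vertex] by (simp add: card card_UNIV_option)
  then have "\<exists>f :: 'n option \<Rightarrow> real ^ 'n. bij_betw f UNIV (vertex ` {..k + 1})"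
    by (rule finite_same_card_bij[rotated 2]) auto
  then show ?thesis
    unfolding vertex_enum_def extr by (rule someI_ex)
qed

text \<open>Carries the concrete numbering over to the coordinate labels fixed by the chosen
  enumeration.\<close>

definition vertex_index :: "nat \<Rightarrow> 'n option" where
  "vertex_index i = inv (vertex_enum row_simplex) (vertex i)"

lemma vertex_enum_index:
  "i \<le> k + 1 \<Longrightarrow> vertex_enum row_simplex (vertex_index i) = vertex i"
  unfolding vertex_index_def
  using bij_vertex_enum by (intro f_inv_into_f) (auto simp: bij_betw_def)

lemma bij_vertex_index: "bij_betw vertex_index {..k + 1} UNIV"
proof -
  have "bij_betw (inv (vertex_enum row_simplex) \<circ> vertex) {..k + 1} UNIV"
    using inj_vertex by (intro bij_betw_trans[OF _ bij_betw_inv_into[OF bij_vertex_enum]])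
      (simp add: bij_betw_def)
  then show ?thesis
    by (simp add: vertex_index_def[abs_def] comp_def)
qed

lemma sum_vertex_index: "(\<Sum>r\<in>UNIV. f r) = (\<Sum>i\<le>k + 1. f (vertex_index i))"
  by (rule sum.reindex_bij_betw[OF bij_vertex_index, symmetric])

lemma all_vertex_index: "(\<forall>r. P r) \<longleftrightarrow> (\<forall>i\<le>k + 1. P (vertex_index i))"
proof -
  have "(\<forall>r. P r) \<longleftrightarrow> (\<forall>r\<in>vertex_index ` {..k + 1}. P r)"
    unfolding bij_betw_imp_surj_on[OF bij_vertex_index] by simp
  then show ?thesis by (simp del: atMost_Suc) auto
qed

lemma all_coordinates: "(\<forall>j. P j) \<longleftrightarrow> (\<forall>m\<in>{1..k + 1}. P (\<iota> m))"
proof -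
  have "(\<forall>j. P j) \<longleftrightarrow> (\<forall>j\<in>\<iota> ` {1..k + 1}. P j)"
    unfolding bij_betw_imp_surj_on[OF bij] by simp
  then show ?thesis by (simp only: ball_simps)
qed

section \<open>The lattice and representatives of its classes\<close>

abbreviation A :: "real ^ 'n option ^ 'n option" where
  "A \<equiv> hom_matrix (vertex_enum row_simplex)"

lemma mult_A_None: "(x v* A) $ None = (\<Sum>i\<le>k + 1. x $ vertex_index i)"
  by (simp add: vector_matrix_mult_def hom_matrix_def sum_vertex_index del: sum.atMost_Suc)

lemma mult_A_Some: "(x v* A) $ Some j = (\<Sum>i\<le>k + 1. x $ vertex_index i * vertex i $ j)"
  by (simp add: vector_matrix_mult_def hom_matrix_def sum_vertex_index vertex_enum_index
      del: sum.atMost_Suc)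

lemma invertible_A: "invertible A"
proof -
  have "x = 0" if "x v* A = 0" for x
  proof -
    have "x $ vertex_index i = 0" if "i \<le> k + 1" for i
    proof (rule vertices_independent[OF _ _ that])
      show "(\<Sum>i\<le>k + 1. x $ vertex_index i) = 0"
        unfolding mult_A_None[symmetric] \<open>x v* A = 0\<close> by simp
      show "(\<Sum>i\<le>k + 1. x $ vertex_index i * vertex i $ \<iota> m) = 0" for m
        unfolding mult_A_Some[symmetric] \<open>x v* A = 0\<close> by simp
    qed
    then show "x = 0"
      using all_vertex_index[of "\<lambda>r. x $ r = 0"] by (simp add: vec_eq_iff)
  qed
  \<comment> \<open>The kernel criterion concerns column vectors, hence the transpose.\<close>
  then have "\<exists>B. B ** transpose A = mat 1"
    by (simp add: matrix_left_invertible_ker)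
  then have "\<exists>B. A ** B = mat 1"
    by (simp only: left_invertible_transpose)
  then show ?thesis
    by (simp add: invertible_right_inverse)
qed

lemma matrix_inv_A: "A ** matrix_inv A = mat 1" "matrix_inv A ** A = mat 1"
  using someI_ex[OF invertible_A[unfolded invertible_def]] unfolding matrix_inv_def by auto

text \<open>Multiplication by \<open>A\<close> undoes the inverse, which therefore never has to be
  computed.\<close>

lemma Lambda_iff_int_vecs: "x \<in> Lambda row_simplex \<longleftrightarrow> x v* A \<in> int_vecs"
proof
  assume "x \<in> Lambda row_simplex"
  then show "x v* A \<in> int_vecs"
    unfolding Lambda_def by (auto simp: vector_matrix_mul_assoc matrix_inv_A)
next
  assume "x v* A \<in> int_vecs"
  moreover have "x = (x v* A) v* matrix_inv A"
    by (simp add: vector_matrix_mul_assoc matrix_inv_A)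
  ultimately show "x \<in> Lambda row_simplex"
    unfolding Lambda_def by blast
qed

lemma Lambda_iff: "x \<in> Lambda row_simplex \<longleftrightarrow> (\<Sum>i\<le>k + 1. x $ vertex_index i) \<in> \<int> \<and>
    (\<forall>m\<in>{1..k}. x $ vertex_index m + x $ vertex_index (k + 1) * real q ^ (k - m) \<in> \<int>) \<and>
    x $ vertex_index (k + 1) * real q ^ k \<in> \<int>"
proof -
  have "{1..k + 1} = insert (k + 1) {1..k}" by auto
  moreover have "x v* A \<in> int_vecs \<longleftrightarrow> (x v* A) $ None \<in> \<int> \<and> (\<forall>j. (x v* A) $ Some j \<in> \<int>)"
    unfolding int_vecs_def by (simp add: split_option_all)
  moreover have "(\<Sum>i\<le>k + 1. x $ vertex_index i * vertex i $ \<iota> (k + 1))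
    = x $ vertex_index (k + 1) * real q ^ k"
    by (subst sum_vertex_nth) auto
  moreover have "(\<Sum>i\<le>k + 1. x $ vertex_index i * vertex i $ \<iota> m)
    = x $ vertex_index m + x $ vertex_index (k + 1) * real q ^ (k - m)" if "m \<in> {1..k}" for m
    using that by (subst sum_vertex_nth) auto
  ultimately show ?thesis
    unfolding Lambda_iff_int_vecs mult_A_None mult_A_Some all_coordinates[of "\<lambda>j. _ j \<in> \<int>"]
    by (simp add: conj_ac del: sum.atMost_Suc)
qed

text \<open>The solution \<open>x\<close> of \<open>x A = (0, \<dots>, 0, l)\<close>.\<close>

definition coord :: "nat \<Rightarrow> nat \<Rightarrow> real" where
  "coord l i = (if i = 0 then (\<Sum>j=1..k - 1. real l / real q ^ j)
    else if i \<le> k then - (real l / real q ^ i) else real l / real q ^ k)"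

definition gen :: "nat \<Rightarrow> real ^ 'n option" where
  "gen l = (\<chi> r. coord l (inv_into {..k + 1} vertex_index r))"

lemma gen_nth: "i \<le> k + 1 \<Longrightarrow> gen l $ vertex_index i = coord l i"
  using bij_vertex_index by (simp add: gen_def bij_betw_def inv_into_f_f)

lemma sum_split_ends: "(\<Sum>i\<le>k + 1. f i) = f 0 + (\<Sum>i=1..k. f i) + f (k + 1)"
  for f :: "nat \<Rightarrow> 'b::comm_monoid_add"
proof -
  have "{..k} = insert 0 {1..k}" by auto
  then show ?thesis by (simp add: add.commute)
qed

lemma sum_atLeast1_k: "(\<Sum>i=1..k. f i) = (\<Sum>i=1..k - 1. f i) + f k"
  for f :: "nat \<Rightarrow> 'b::comm_monoid_add"
  using k by (cases k) simp_all

text \<open>The entry at \<open>k + 1\<close> cancels the one at \<open>k\<close>, which is why the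
  entry at the origin stops at \<open>j = k - 1\<close>.\<close>

lemma sum_coord: "(\<Sum>i\<le>k + 1. coord l i) = 0"
proof -
  have "(\<Sum>i=1..k. coord l i) = - (\<Sum>i=1..k. real l / real q ^ i)"
    unfolding sum_negf[symmetric] by (intro sum.cong) (auto simp: coord_def)
  then show ?thesis
    unfolding sum_split_ends sum_atLeast1_k by (simp add: coord_def)
qed

lemma gen_in_Lambda: "gen l \<in> Lambda row_simplex"
proof -
  have "(\<Sum>i\<le>k + 1. gen l $ vertex_index i) = (\<Sum>i\<le>k + 1. coord l i)"
    by (intro sum.cong) (auto simp: gen_nth)
  moreover have "gen l $ vertex_index m + gen l $ vertex_index (k + 1) * real q ^ (k - m) = 0"
    if "m \<in> {1..k}" for m
    using that q by (simp add: gen_nth coord_def power_diff)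
  ultimately show ?thesis
    unfolding Lambda_iff sum_coord using q by (simp add: gen_nth coord_def)
qed

text \<open>The last coordinate modulo 1 determines the class: it is \<open>L / q^k\<close>, and
  \<open>l\<close> is the residue of \<open>L\<close>. The column conditions then fix the other
  coordinates modulo 1.\<close>

lemma Lambda_eq_gen:
  assumes x: "x \<in> Lambda row_simplex"
  shows "\<exists>l<q ^ k. x - gen l \<in> int_vecs"
proof -
  define y where "y i = x $ vertex_index i" for i
  have y: "(\<Sum>i\<le>k + 1. y i) \<in> \<int>" "\<And>m. m \<in> {1..k} \<Longrightarrow> y m + y (k + 1) * real q ^ (k - m) \<in> \<int>"
    "y (k + 1) * real q ^ k \<in> \<int>"
    using x unfolding Lambda_iff y_def by auto
  from y(3) obtain L where L: "y (k + 1) * real q ^ k = of_int L"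
    by (elim Ints_cases)
  define l where "l = nat (L mod int (q ^ k))"
  have l: "l < q ^ k" "int l = L mod int (q ^ k)"
    unfolding l_def using q by (simp_all add: nat_less_iff)
  have "L = int (q ^ k) * (L div int (q ^ k)) + int l"
    unfolding l(2) by simp
  then have "real_of_int L = real q ^ k * of_int (L div int (q ^ k)) + real l"
    by (metis of_int_add of_int_mult of_int_of_nat_eq of_nat_power)
  then have "y (k + 1) - coord l (k + 1) = of_int (L div int (q ^ k))"
    unfolding L[symmetric] using q by (simp add: coord_def field_simps)
  then have last: "y (k + 1) - coord l (k + 1) \<in> \<int>"
    by simp
  have mid: "y m - coord l m \<in> \<int>" if m: "m \<in> {1..k}" for m
  proof -
    \<comment> \<open>For \<open>coord l\<close> the expression in column \<open>m\<close> is 0, so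
      only the integral expression for \<open>y\<close> remains.\<close>
    have "y m - coord l m = (y m + y (k + 1) * real q ^ (k - m))
      - (y (k + 1) - coord l (k + 1)) * real q ^ (k - m)"
      using m q by (simp add: coord_def power_diff field_simps)
    also have "\<dots> \<in> \<int>"
      by (rule Ints_diff[OF y(2)[OF m] Ints_mult[OF last Ints_power[OF Ints_of_nat]]])
    finally show ?thesis .
  qed
  \<comment> \<open>The coordinate at the origin is recovered from the integral total.\<close>
  have "y 0 - coord l 0 = (\<Sum>i\<le>k + 1. y i - coord l i) - (\<Sum>i=1..k. y i - coord l i)
      - (y (k + 1) - coord l (k + 1))"
    unfolding sum_split_ends by simp
  also have "(\<Sum>i\<le>k + 1. y i - coord l i) = (\<Sum>i\<le>k + 1. y i)"
    unfolding sum_subtractf sum_coord by simp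
  also have "\<dots> - (\<Sum>i=1..k. y i - coord l i) - (y (k + 1) - coord l (k + 1)) \<in> \<int>"
    by (rule Ints_diff[OF Ints_diff[OF y(1) Ints_sum] last]) (rule mid)
  finally have first: "y 0 - coord l 0 \<in> \<int>" .
  have "y i - coord l i \<in> \<int>" if "i \<le> k + 1" for i
    using first mid last that by (cases "i = 0"; cases "i = k + 1") auto
  then have "x - gen l \<in> int_vecs"
    unfolding int_vecs_def mem_Collect_eq all_vertex_index[of "\<lambda>r. _ $ r \<in> \<int>"]
    by (simp add: y_def gen_nth)
  then show ?thesis
    using l(1) by blast
qed

text \<open>The last coordinates \<open>l / q^k\<close> and \<open>l' / q^k\<close> lie in
  \<open>[0, 1)\<close>, so an integral difference vanishes.\<close>

lemma gen_cong_imp_eq: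
  assumes "gen l - gen l' \<in> int_vecs" "l < q ^ k" "l' < q ^ k"
  shows "l = l'"
proof -
  have "gen l $ vertex_index (k + 1) - gen l' $ vertex_index (k + 1) \<in> \<int>"
    using assms(1) unfolding int_vecs_def by simp
  then have Z: "(real l - real l') / real q ^ k \<in> \<int>"
    by (simp add: gen_nth coord_def diff_divide_distrib)
  have "real l < real (q ^ k)" "real l' < real (q ^ k)"
    using assms by (simp_all only: of_nat_less_iff)
  then have "real l < real l' + real q ^ k" "real l' < real l + real q ^ k"
    unfolding of_nat_power by linarith+
  then have "\<bar>(real l - real l') / real q ^ k\<bar> < 1"
    using q by (simp add: abs_less_iff field_simps)
  then have "(real l - real l') / real q ^ k = 0"
    using Z by (elim Ints_cases) (simp flip: of_int_abs)
  then show ?thesis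
    using q by simp
qed

section \<open>The quotient group\<close>

abbreviation lattice_cong :: "((real ^ 'n option) \<times> (real ^ 'n option)) set" where
  "lattice_cong \<equiv>
    {(x, y). x \<in> Lambda row_simplex \<and> y \<in> Lambda row_simplex \<and> x - y \<in> int_vecs}"

lemma equiv_lattice_cong: "equiv (Lambda row_simplex) lattice_cong"
proof (rule equivI)
  show "sym lattice_cong"
  proof (rule symI)
    fix x y assume *: "(x, y) \<in> lattice_cong"
    then have "- (x $ i - y $ i) \<in> \<int>" for i
      unfolding int_vecs_def by (intro Ints_minus) auto
    with * show "(y, x) \<in> lattice_cong"
      unfolding int_vecs_def by simp
  qed
  show "trans lattice_cong"
  proof (rule transI)
    fix x y z assume *: "(x, y) \<in> lattice_cong" "(y, z) \<in> lattice_cong"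
    then have "(x $ i - y $ i) + (y $ i - z $ i) \<in> \<int>" for i
      unfolding int_vecs_def by (intro Ints_add) auto
    with * show "(x, z) \<in> lattice_cong"
      unfolding int_vecs_def by simp
  qed
qed (auto simp: refl_on_def int_vecs_def)

definition gen_class :: "nat \<Rightarrow> (real ^ 'n option) set" where
  "gen_class l = lattice_cong `` {gen l}"

lemma Gamma_eq: "Gamma row_simplex = gen_class ` {..<q ^ k}"
proof
  show "Gamma row_simplex \<subseteq> gen_class ` {..<q ^ k}"
  proof
    fix X assume "X \<in> Gamma row_simplex"
    then obtain x where x: "x \<in> Lambda row_simplex" "X = lattice_cong `` {x}"
      unfolding Gamma_def by (auto elim: quotientE)
    then obtain l where l: "l < q ^ k" "x - gen l \<in> int_vecs"
      using Lambda_eq_gen by blast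
    then have "(x, gen l) \<in> lattice_cong"
      using x gen_in_Lambda by simp
    then have "X = gen_class l"
      unfolding x(2) gen_class_def by (rule equiv_class_eq[OF equiv_lattice_cong])
    with l show "X \<in> gen_class ` {..<q ^ k}" by blast
  qed
  show "gen_class ` {..<q ^ k} \<subseteq> Gamma row_simplex"
    unfolding Gamma_def gen_class_def by (intro image_subsetI quotientI gen_in_Lambda)
qed

lemma inj_gen_class: "inj_on gen_class {..<q ^ k}"
proof (rule inj_onI)
  fix l l' assume *: "l \<in> {..<q ^ k}" "l' \<in> {..<q ^ k}" "gen_class l = gen_class l'"
  then have "(gen l, gen l') \<in> lattice_cong"
    using eq_equiv_class[OF _ equiv_lattice_cong] gen_in_Lambda unfolding gen_class_def by blast
  with * show "l = l'"
    by (intro gen_cong_imp_eq) auto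
qed

lemma gen_class_memD:
  assumes "x \<in> gen_class l"
  shows "\<exists>z. x $ i = gen l $ i + of_int z"
proof -
  have "gen l $ i - x $ i \<in> \<int>"
    using assms unfolding gen_class_def int_vecs_def by auto
  then obtain z where "gen l $ i - x $ i = of_int z"
    by (elim Ints_cases)
  then show ?thesis
    by (intro exI[of _ "- z"]) simp
qed

lemma gen_in_gen_class: "gen l \<in> gen_class l"
  unfolding gen_class_def using gen_in_Lambda by (simp add: int_vecs_def)

text \<open>Integer shifts leave fractional parts alone, so the representative picked by
  \<open>SOME\<close> may be replaced by \<open>gen l\<close>.\<close>

lemma class_age_gen_class: "class_age (gen_class l) = nat \<lfloor>age (gen l)\<rfloor>"
proof -
  have "age x = age (gen l)" if "x \<in> gen_class l" for x
    unfolding age_def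
  proof (rule sum.cong[OF refl])
    fix i
    show "frac (x $ i) = frac (gen l $ i)"
      using gen_class_memD[OF that, of i] by auto
  qed
  moreover have "(SOME x. x \<in> gen_class l) \<in> gen_class l"
    using gen_in_gen_class by (rule someI)
  ultimately show ?thesis
    unfolding class_age_def by simp
qed

section \<open>Integral coordinates\<close>

lemma of_nat_div_Ints_imp_dvd:
  assumes "real l / real q ^ i \<in> \<int>" "i > 0"
  shows "q dvd l"
proof -
  from assms(1) obtain z where "real l / real q ^ i = of_int z"
    by (elim Ints_cases)
  then have "real_of_int (int l) = real_of_int (z * int q ^ i)"
    using q by (simp add: field_simps)
  then have "int q ^ i dvd int l"
    unfolding of_int_eq_iff by simp
  then have "int q dvd int l"
    using assms(2) by (meson dvd_power dvd_trans)
  then show ?thesis by simp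
qed

text \<open>Multiplication by \<open>q^(n-1)\<close> makes every summand but the last integral and
  turns the last into \<open>l / q\<close>.\<close>

lemma sum_geometric_Ints_imp_dvd:
  assumes "(\<Sum>j=1..n. real l / real q ^ j) \<in> \<int>" "n > 0"
  shows "q dvd l"
proof -
  obtain p where n: "n = Suc p"
    using assms(2) gr0_conv_Suc by blast
  have "(\<Sum>j=1..p. real l / real q ^ j) * real q ^ p = (\<Sum>j=1..p. real l * real q ^ (p - j))"
    unfolding sum_distrib_right using q by (intro sum.cong) (auto simp: power_diff)
  then have "real l / real q ^ 1
    = (\<Sum>j=1..n. real l / real q ^ j) * real q ^ p - (\<Sum>j=1..p. real l * real q ^ (p - j))"
    using q unfolding n by (simp add: distrib_right)
  also have "\<dots> \<in> \<int>"
    by (rule Ints_diff[OF Ints_mult[OF assms(1)]]) (auto intro!: Ints_sum Ints_mult Ints_power)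
  finally show ?thesis
    by (rule of_nat_div_Ints_imp_dvd) simp
qed

lemma gen_nonintegral_iff: "(\<forall>r. gen l $ r \<notin> \<int>) \<longleftrightarrow> \<not> q dvd l"
proof -
  have "coord l i \<notin> \<int>" if "\<not> q dvd l" for i
    using that k of_nat_div_Ints_imp_dvd sum_geometric_Ints_imp_dvd[of l "k - 1"]
    by (auto simp: coord_def minus_in_Ints_iff)
  \<comment> \<open>Conversely, the single coordinate \<open>- l / q\<close> detects
    divisibility.\<close>
  moreover have "coord l 1 \<in> \<int>" if "q dvd l"
    using that k q by (auto simp: coord_def elim!: dvdE)
  ultimately show ?thesis
    unfolding all_vertex_index[of "\<lambda>r. _ $ r \<notin> \<int>"] by (force simp: gen_nth)
qed

lemma gen_class_nonintegral_iff: "(\<forall>x\<in>gen_class l. \<forall>i. x $ i \<notin> \<int>) \<longleftrightarrow> \<not> q dvd l"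
proof -
  have "x $ i \<in> \<int> \<longleftrightarrow> gen l $ i \<in> \<int>" if "x \<in> gen_class l" for x i
    using gen_class_memD[OF that, of i] by auto
  then show ?thesis
    unfolding gen_nonintegral_iff[symmetric] using gen_in_gen_class by blast
qed

section \<open>Ages of the classes\<close>

definition carry :: "nat \<Rightarrow> nat" where
  "carry l = (digit_sum q (k - 1) l - 1) div (q - 1)"

text \<open>The outer \<open>nat\<close> truncates nothing: \<open>carry l \<le> k\<close>.\<close>

lemma nat_floor_age_gen:
  assumes l: "\<not> q dvd l"
  shows "int (nat \<lfloor>age (gen l)\<rfloor>) = int k - int (carry l)"
proof -
  define T where "T = (\<Sum>i=1..k - 1. frac (real l / real q ^ i))"
  have nonint: "real l / real q ^ i \<notin> \<int>" if "i > 0" for i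
    using of_nat_div_Ints_imp_dvd[OF _ that] l by blast
  have floor: "\<lfloor>T\<rfloor> = int (carry l)"
    unfolding T_def carry_def using floor_sum_frac[of q "k - 1" l] q k l by simp
  have "T \<le> (\<Sum>i=1..k - 1. 1)"
    unfolding T_def by (intro sum_mono less_imp_le frac_lt_1)
  then have le: "carry l \<le> k"
    using floor by simp linarith
  \<comment> \<open>The entry at the origin agrees with \<open>T\<close> modulo 1, so its fractional
    part is \<open>T\<close> minus the floor of \<open>T\<close>.\<close>
  have "coord l 0 - T = (\<Sum>i=1..k - 1. of_int \<lfloor>real l / real q ^ i\<rfloor>)"
    unfolding coord_def T_def by (simp add: frac_def flip: sum_subtractf)
  then have "coord l 0 - T \<in> \<int>"
    by (auto intro!: Ints_sum)
  then have "frac (coord l 0) = frac T"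
    using frac_add_int_left[of "coord l 0 - T" T] by simp
  also have "\<dots> = T - real (carry l)"
    unfolding frac_def floor by simp
  finally have first: "frac (coord l 0) = T - real (carry l)" .
  \<comment> \<open>Uses \<open>frac (- t) = 1 - frac t\<close>, valid for non-integral
    \<open>t\<close>.\<close>
  have "(\<Sum>i=1..k. frac (coord l i)) = (\<Sum>i=1..k. 1 - frac (real l / real q ^ i))"
    using nonint by (intro sum.cong) (auto simp: coord_def frac_neg)
  also have "\<dots> = real k - (T + frac (real l / real q ^ k))"
    unfolding sum_subtractf sum_atLeast1_k[of "\<lambda>i. frac (real l / real q ^ i)"] T_def by simp
  finally have mid: "(\<Sum>i=1..k. frac (coord l i)) = real k - (T + frac (real l / real q ^ k))" .
  have "age (gen l) = (\<Sum>i\<le>k + 1. frac (coord l i))"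
    unfolding age_def sum_vertex_index by (intro sum.cong) (auto simp: gen_nth)
  \<comment> \<open>\<open>T\<close> cancels between the origin and the middle entries, and
    \<open>frac (l / q^k)\<close> cancels against the last entry.\<close>
  also have "\<dots> = real k - real (carry l)"
    unfolding sum_split_ends first mid by (simp add: coord_def)
  also have "\<dots> = real (k - carry l)"
    using le by (simp add: of_nat_diff)
  finally have "\<lfloor>age (gen l)\<rfloor> = int (k - carry l)"
    by (simp only: floor_of_nat)
  then show ?thesis
    using le by (simp add: of_nat_diff)
qed

section \<open>Coefficients and unimodality\<close>

lemma local_hstar_eq:
  "local_hstar row_simplex = (\<Sum>l | l < q ^ k \<and> \<not> q dvd l. monom 1 (nat \<lfloor>age (gen l)\<rfloor>))"
proof -
  have "{X \<in> Gamma row_simplex. \<forall>x\<in>X. \<forall>i. x $ i \<notin> \<int>} = gen_class ` {l. l < q ^ k \<and> \<not> q dvd l}"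
    unfolding Gamma_eq using gen_class_nonintegral_iff by auto
  moreover have "inj_on gen_class {l. l < q ^ k \<and> \<not> q dvd l}"
    using inj_gen_class by (rule inj_on_subset) auto
  ultimately show ?thesis
    unfolding local_hstar_def by (simp add: sum.reindex class_age_gen_class)
qed

text \<open>Age \<open>j\<close> means \<open>carry l = k - j\<close>, a condition on the lowest
  \<open>k - 1\<close> digits alone; the free top digit gives the factor \<open>q\<close>, and the
  block for \<open>r = k - j\<close> gives the window.\<close>

lemma coeff_local_hstar:
  "coeff (local_hstar row_simplex) j
    = int q * (\<Sum>i<q - 1. digit_sum_count q (k - 1) ((int q - 1) * (int k - int j + 1) - int i))"
proof -
  define n where "n = k - 1"
  have n: "k = Suc n" "n > 0"
    using k by (auto simp: n_def)
  let ?P = "\<lambda>l. \<not> q dvd l \<and> int ((digit_sum q n l - 1) div (q - 1)) = int k - int j"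
  have P_mod: "?P (l mod q ^ n) \<longleftrightarrow> ?P l" for l
    using n(2) by (simp add: digit_sum_mod dvd_mod_iff)
  have age_iff: "nat \<lfloor>age (gen l)\<rfloor> = j \<longleftrightarrow>
      int ((digit_sum q n l - 1) div (q - 1)) = int k - int j" if "\<not> q dvd l" for l
    using nat_floor_age_gen[OF that] unfolding carry_def n_def[symmetric] by linarith
  have "coeff (local_hstar row_simplex) j
    = (\<Sum>l | l < q ^ k \<and> \<not> q dvd l. if nat \<lfloor>age (gen l)\<rfloor> = j then 1 else 0)"
    unfolding local_hstar_eq coeff_sum by simp
  also have "\<dots> = int (card {l \<in> {l. l < q ^ k \<and> \<not> q dvd l}. nat \<lfloor>age (gen l)\<rfloor> = j})"
    by (simp add: sum.If_cases Int_def)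
  also have "{l \<in> {l. l < q ^ k \<and> \<not> q dvd l}. nat \<lfloor>age (gen l)\<rfloor> = j}
    = {l. l < q ^ Suc n \<and> ?P (l mod q ^ n)}"
    unfolding P_mod n(1)[symmetric] using age_iff by blast
  also have "card \<dots> = (\<Sum>d<q. card {l. l < q ^ n \<and> ?P l})"
    using q by (intro card_split_top_digit) simp
  also have "int \<dots> = int q * int (card {l. l < q ^ n \<and> ?P l})"
    by simp
  finally show ?thesis
    unfolding n_def[symmetric] card_digit_sum_block[OF q n(2), symmetric] .
qed

lemma unimodal_local_hstar: "unimodal (local_hstar row_simplex)"
proof -
  obtain \<sigma> where "centred \<sigma> (digit_sum_count q (k - 1))"
    using digit_sum_count_centred[of q "k - 1"] q k by auto
  \<comment> \<open>Summing over blocks of \<open>q - 1\<close> digit sums is one more window, and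
    the factor \<open>q\<close> preserves the order.\<close>
  from centred_window[OF this, of "q - 1"]
  have "centred (\<sigma> + int (q - 1) - 1)
    (\<lambda>m. int q * (\<Sum>i<q - 1. digit_sum_count q (k - 1) (m - int i)))"
    unfolding centred_def by (auto intro: mult_left_mono)
  then show ?thesis
    \<comment> \<open>The block tops \<open>(q - 1) (k - j + 1)\<close> form a progression in
      \<open>j\<close> with step \<open>- (q - 1)\<close>.\<close>
    by (rule unimodal_if_centred[where \<alpha> = "(int q - 1) * (int k + 1)" and \<beta> = "int q - 1"])
      (simp add: coeff_local_hstar algebra_simps)
qed

end

theorem theorem3p9:
  fixes q k :: nat and \<iota> :: "nat \<Rightarrow> 'n::finite"
  assumes "q \<ge> 2" and "k \<ge> 2"
    and "CARD('n) = k + 1"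
    and "bij_betw \<iota> {1..k + 1} UNIV"
  shows "unimodal (local_hstar
           (one_row_hnf_simplex \<iota> (\<lambda>i. if i \<le> k then int q ^ (k - i) else int q ^ k)))"
  using geometric_row.unimodal_local_hstar[OF geometric_row.intro[OF assms]] .

end
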